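(* Let $c:\mathbb{R}^n\times\mathbb{R}^m\to\mathbb{R}$ be Lipschitz continuous, with $c(\cdot,y)$ convex for every $y\in\mathbb{R}^m$ and $c(x,\cdot)$ concave for every $x\in\mathbb{R}^n$. Let $g:\mathbb{R}^n\to\mathbb{R}^{\hat n}$ and $h:\mathbb{R}^m\to\mathbb{R}^{\hat m}$ be continuously differentiable, let $X\subset\mathbb{R}^n$ and $Y\subset\mathbb{R}^m$ be convex and compact, and let $\lambda_1,\lambda_2>0$. Let $\rho:\mathbb{R}\to[0,+\infty)$ be a piecewise continuous density function with $\rho(s)=0$ for all $s\notin[0,\alpha]$, where $\alpha>0$, and let $r(t,\mu)=\int_{-\infty}^{t/\mu}\rho(s)\,ds$. Consider $$(\mathrm{P})\quad \min_{x\in X}\max_{y\in Y} f(x,y):=c(x,y)+\lambda_1\|g(x)_+\|_0-\lambda_2\|h(y)_+\|_0,$$ $$(\mathrm{P}_\mu)\quad \min_{x\in X}\max_{y\in Y} f^R(x,y,\mu):=c(x,y)+\lambda_1\sum_{i=1}^{\hat n} r(g_i(x),\mu)-\lambda_2\sum_{j=1}^{\hat m} r(h_j(y),\mu).$$ Let $\mu>0$ be such that the following two conditions hold: - for any $\bar y\in Y$, if $x^*$ is a local minimizer of $f^R(\cdot,\bar y,\mu)$ on $X$, then $g_i(x^* )\notin(0,\alpha\mu)$ for all $i\in\{1,\dots,\hat n\}$; - for any $\bar x\in X$, if $y^*$ is a local maximizer of $f^R(\bar x,\cdot,\mu)$ on $Y$, then $h_j(y^* )\notin(0,\alpha\mu)$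 for all $j\in\{1,\dots,\hat m\}$. Then: (i) $(x^*,y^* )$ is a saddle point of $(\mathrm{P})$ if and only if it is a saddle point of $(\mathrm{P}_\mu)$; (ii) $(x^*,y^* )$ is a local saddle point of $(\mathrm{P})$ if it is a local saddle point of $(\mathrm{P}_\mu)$.
   Context: For $a\in\mathbb{R}^k$, $\|a_+\|_0$ denotes the number of indices $i$ with $a_i>0$. A density function is a nonnegative function with integral $1$. $\mathbf{B}(z,\delta)$ is the closed ball with center $z$ and radius $\delta$. A point $(x^*,y^* )\in X\times Y$ is a saddle point of $\min_{x\in X}\max_{y\in Y}F(x,y)$ if $F(x^*,y)\le F(x^*,y^* )\le F(x,y^* )$ for all $(x,y)\in X\times Y$. It is a local saddle point if there is a $\delta>0$ such that these inequalities hold for all $x\in X\cap\mathbf{B}(x^*,\delta)$ and $y\in Y\cap\mathbf{B}(y^*,\delta)$. *)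

theory Defs
  imports "HOL-Analysis.Analysis"
begin

definition C1_map :: "('a::real_normed_vector \<Rightarrow> 'b::real_normed_vector) \<Rightarrow> bool" where
  "C1_map g \<longleftrightarrow>
     (\<exists>g' :: 'a \<Rightarrow> 'a \<Rightarrow>\<^sub>L 'b.
        (\<forall>x. (g has_derivative blinfun_apply (g' x)) (at x)) \<and> continuous_on UNIV g')"

text \<open>Finitely many discontinuities on every bounded interval, all of them with finite one-sided
  limits; the value at a discontinuity is arbitrary.\<close>

definition piecewise_continuous :: "(real \<Rightarrow> real) \<Rightarrow> bool" where
  "piecewise_continuous \<rho> \<longleftrightarrow>
     (\<forall>a b. finite {s \<in> {a..b}. \<not> isCont \<rho> s}) \<and>
     (\<forall>s. (\<exists>l. (\<rho> \<longlongrightarrow> l) (at_left s)) \<and> (\<exists>l. (\<rho> \<longlongrightarrow> l) (at_right s)))"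

definition density_function :: "(real \<Rightarrow> real) \<Rightarrow> bool" where
  "density_function \<rho> \<longleftrightarrow> (\<forall>s. 0 \<le> \<rho> s) \<and> has_bochner_integral lborel \<rho> 1"

definition smoothed_step :: "(real \<Rightarrow> real) \<Rightarrow> real \<Rightarrow> real \<Rightarrow> real" where
  "smoothed_step \<rho> t \<mu> = (LBINT s:{..t / \<mu>}. \<rho> s)"

text \<open>The quantity \<open>\<parallel>a\<^sub>+\<parallel>\<^sub>0\<close>.\<close>

definition pos_count :: "real ^ 'k \<Rightarrow> nat" where
  "pos_count a = card {i. a $ i > 0}"

definition obj ::
  "((real ^ 'n) \<times> (real ^ 'm) \<Rightarrow> real) \<Rightarrow> (real ^ 'n \<Rightarrow> real ^ 'p) \<Rightarrow> (real ^ 'm \<Rightarrow> real ^ 'q)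
    \<Rightarrow> real \<Rightarrow> real \<Rightarrow> real ^ 'n \<Rightarrow> real ^ 'm \<Rightarrow> real" where
  "obj c g h lam1 lam2 x y =
     c (x, y) + lam1 * real (pos_count (g x)) - lam2 * real (pos_count (h y))"

definition smoothed_obj ::
  "((real ^ 'n) \<times> (real ^ 'm) \<Rightarrow> real) \<Rightarrow> (real ^ 'n \<Rightarrow> real ^ 'p) \<Rightarrow> (real ^ 'm \<Rightarrow> real ^ 'q)
    \<Rightarrow> real \<Rightarrow> real \<Rightarrow> (real \<Rightarrow> real) \<Rightarrow> real ^ 'n \<Rightarrow> real ^ 'm \<Rightarrow> real \<Rightarrow> real" where
  "smoothed_obj c g h lam1 lam2 \<rho> x y \<mu> =
     c (x, y) + lam1 * (\<Sum>i\<in>UNIV. smoothed_step \<rho> (g x $ i) \<mu>)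
              - lam2 * (\<Sum>j\<in>UNIV. smoothed_step \<rho> (h y $ j) \<mu>)"

definition local_minimizer :: "('a::metric_space \<Rightarrow> real) \<Rightarrow> 'a set \<Rightarrow> 'a \<Rightarrow> bool" where
  "local_minimizer \<phi> X xs \<longleftrightarrow>
     xs \<in> X \<and> (\<exists>\<delta>>0. \<forall>x \<in> X \<inter> cball xs \<delta>. \<phi> xs \<le> \<phi> x)"

definition local_maximizer :: "('a::metric_space \<Rightarrow> real) \<Rightarrow> 'a set \<Rightarrow> 'a \<Rightarrow> bool" where
  "local_maximizer \<phi> X xs \<longleftrightarrow>
     xs \<in> X \<and> (\<exists>\<delta>>0. \<forall>x \<in> X \<inter> cball xs \<delta>. \<phi> x \<le> \<phi> xs)"

definition saddle_point ::
  "('a \<Rightarrow> 'b \<Rightarrow> real) \<Rightarrow> 'a set \<Rightarrow> 'b set \<Rightarrow> 'a \<times> 'b \<Rightarrow> bool" where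
  "saddle_point F X Y = (\<lambda>(xs, ys).
     xs \<in> X \<and> ys \<in> Y \<and> (\<forall>x\<in>X. \<forall>y\<in>Y. F xs y \<le> F xs ys \<and> F xs ys \<le> F x ys))"

definition local_saddle_point ::
  "('a::metric_space \<Rightarrow> 'b::metric_space \<Rightarrow> real) \<Rightarrow> 'a set \<Rightarrow> 'b set \<Rightarrow> 'a \<times> 'b \<Rightarrow> bool" where
  "local_saddle_point F X Y = (\<lambda>(xs, ys).
     xs \<in> X \<and> ys \<in> Y \<and>
     (\<exists>\<delta>>0. \<forall>x \<in> X \<inter> cball xs \<delta>. \<forall>y \<in> Y \<inter> cball ys \<delta>.
        F xs y \<le> F xs ys \<and> F xs ys \<le> F x ys))"

end

theory Submission
  imports Defs
begin

text \<open>
  The smoothed step takes values in \<open>[0, 1]\<close>, vanishes on \<open>(-\<infinity>, 0]\<close> and equals \<open>1\<close> on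
  \<open>[\<alpha>\<mu>, \<infinity>)\<close>, so it never exceeds the indicator of \<open>(0, \<infinity>)\<close> and agrees with it outside
  \<open>(0, \<alpha>\<mu>)\<close>. Hence the smoothed penalty underestimates the cardinality penalty, and the two
  coincide at every point none of whose constraint values lies in \<open>(0, \<alpha>\<mu>)\<close>. By hypothesis every
  local minimizer in \<open>x\<close> and every local maximizer in \<open>y\<close> of the smoothed objective is such a point.

  A saddle point consists of a minimizer in \<open>x\<close> and a maximizer in \<open>y\<close>, and changing the sign
  turns the second into the first, so everything reduces to minimizing \<open>\<phi> + a\<close> versus \<open>\<phi> + A\<close>
  over one compact set, where \<open>a \<le> A\<close>. If \<open>z\<close> minimizes the smaller function and \<open>a z = A z\<close>,
  then \<open>z\<close> minimizes the larger one too; this needs only the points near \<open>z\<close>, so it also settles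
  the local assertion. Conversely, let \<open>z\<close> minimize \<open>\<phi> + A\<close>. By continuity and compactness,
  \<open>\<phi> + a\<close> has some minimizer \<open>w\<close>, where \<open>a w = A w\<close>, and
  \<open>\<phi> z + a z \<le> \<phi> z + A z \<le> \<phi> w + A w = \<phi> w + a w\<close>,
  so \<open>z\<close> is a minimizer of \<open>\<phi> + a\<close> as well (\<open>minimizer_relaxation_iff\<close>). This argument
  has no local version, because \<open>w\<close> may be far from \<open>z\<close>.
\<close>

section \<open>The smoothed step function\<close>

lemma smoothed_step_le_1:
  assumes "density_function \<rho>"
  shows "smoothed_step \<rho> t \<mu> \<le> 1"
proof -
  have int: "integrable lborel \<rho>" and one: "integral\<^sup>L lborel \<rho> = 1" and nonneg: "\<And>s. 0 \<le> \<rho> s"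
    using assms by (auto simp: density_function_def has_bochner_integral_iff)
  have "integral\<^sup>L lborel (\<lambda>s. indicator {..t / \<mu>} s *\<^sub>R \<rho> s) \<le> integral\<^sup>L lborel \<rho>"
  proof (rule integral_mono)
    show "integrable lborel (\<lambda>s. indicator {..t / \<mu>} s *\<^sub>R \<rho> s)"
      by (rule integrable_mult_indicator) (use int in auto)
  qed (use int nonneg in \<open>auto split: split_indicator\<close>)
  then show ?thesis
    by (simp add: smoothed_step_def set_lebesgue_integral_def one)
qed

lemma smoothed_step_nonpos:
  assumes "\<And>s. s < 0 \<Longrightarrow> \<rho> s = 0" and "\<mu> > 0" and "t \<le> 0"
  shows "smoothed_step \<rho> t \<mu> = 0"
proof -
  have "t / \<mu> \<le> 0"
    using assms by (simp add: divide_le_0_iff)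
  \<comment> \<open>The density may be nonzero at the origin, which is a null set.\<close>
  have "AE s in lborel. indicator {..t / \<mu>} s *\<^sub>R \<rho> s = 0"
    using AE_lborel_singleton[of 0]
  proof eventually_elim
    case (elim s)
    then show ?case
      using assms(1)[of s] \<open>t / \<mu> \<le> 0\<close> by (auto split: split_indicator)
  qed
  then show ?thesis
    unfolding smoothed_step_def set_lebesgue_integral_def by (rule integral_eq_zero_AE)
qed

lemma smoothed_step_eq_1:
  assumes "density_function \<rho>" and "\<And>s. s > \<alpha> \<Longrightarrow> \<rho> s = 0" and "\<mu> > 0" and "t \<ge> \<alpha> * \<mu>"
  shows "smoothed_step \<rho> t \<mu> = 1"
proof -
  have "\<alpha> \<le> t / \<mu>"
    using assms by (simp add: pos_le_divide_eq)
  then have "(\<lambda>s. indicator {..t / \<mu>} s *\<^sub>R \<rho> s) = \<rho>"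
    using assms(2) by (force split: split_indicator)
  then show ?thesis
    using assms(1)
    by (simp add: smoothed_step_def set_lebesgue_integral_def density_function_def
        has_bochner_integral_iff)
qed

text \<open>The integrands converge off the single point \<open>t / \<mu>\<close> and are dominated by the density itself.\<close>

lemma continuous_on_smoothed_step:
  assumes "density_function \<rho>"
  shows "continuous_on S (\<lambda>t. smoothed_step \<rho> t \<mu>)"
proof -
  have int: "integrable lborel \<rho>" and nonneg: "\<And>s. 0 \<le> \<rho> s"
    using assms by (auto simp: density_function_def has_bochner_integral_iff)
  have "(\<lambda>n. smoothed_step \<rho> (u n) \<mu>) \<longlonglongrightarrow> smoothed_step \<rho> t \<mu>" if u: "u \<longlonglongrightarrow> t" for u t
    unfolding smoothed_step_def set_lebesgue_integral_def
  proof (rule integral_dominated_convergence[where w = \<rho>])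
    have lim: "(\<lambda>n. u n / \<mu>) \<longlonglongrightarrow> t / \<mu>"
      unfolding divide_inverse by (intro tendsto_intros u)
    show "AE s in lborel. (\<lambda>n. indicator {..u n / \<mu>} s *\<^sub>R \<rho> s)
            \<longlonglongrightarrow> indicator {..t / \<mu>} s *\<^sub>R \<rho> s"
      using AE_lborel_singleton[of "t / \<mu>"]
    proof eventually_elim
      case (elim s)
      then consider "s < t / \<mu>" | "s > t / \<mu>" by linarith
      then show ?case
      proof cases
        case 1
        then have "\<forall>\<^sub>F n in sequentially. s < u n / \<mu>"
          using order_tendstoD(1)[OF lim] by blast
        then show ?thesis
          using 1 by (intro tendsto_eventually, elim eventually_mono) simp
      next
        case 2
        then have "\<forall>\<^sub>F n in sequentially. u n / \<mu> < s"
          using order_tendstoD(2)[OF lim] by blast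
        then show ?thesis
          using 2 by (intro tendsto_eventually, elim eventually_mono) simp
      qed
    qed
  next
    show "AE s in lborel. norm (indicator {..u n / \<mu>} s *\<^sub>R \<rho> s) \<le> \<rho> s" for n
      using nonneg by (auto split: split_indicator)
  qed (use int in auto)
  then show ?thesis
    by (auto simp: continuous_on_sequentially comp_def)
qed

section \<open>The smoothed penalty and the cardinality penalty\<close>

lemma pos_count_eq_sum: "real (pos_count v) = (\<Sum>i\<in>UNIV. of_bool (v $ i > 0))"
  by (simp add: pos_count_def of_bool_def sum.If_cases)

lemma sum_smoothed_step_le_pos_count:
  assumes "density_function \<rho>" and "\<And>s. s < 0 \<Longrightarrow> \<rho> s = 0" and "\<mu> > 0"
  shows "(\<Sum>i\<in>UNIV. smoothed_step \<rho> (v $ i) \<mu>) \<le> real (pos_count v)"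
  unfolding pos_count_eq_sum
proof (rule sum_mono)
  show "smoothed_step \<rho> (v $ i) \<mu> \<le> of_bool (v $ i > 0)" for i
    using smoothed_step_le_1[OF assms(1), where t = "v $ i" and \<mu> = \<mu>]
      smoothed_step_nonpos[OF assms(2,3), where t = "v $ i"] by auto
qed

lemma sum_smoothed_step_eq_pos_count:
  assumes "density_function \<rho>" and "\<And>s. s \<notin> {0..\<alpha>} \<Longrightarrow> \<rho> s = 0" and "\<alpha> > 0" and "\<mu> > 0"
    and "\<And>i. v $ i \<notin> {0<..<\<alpha> * \<mu>}"
  shows "(\<Sum>i\<in>UNIV. smoothed_step \<rho> (v $ i) \<mu>) = real (pos_count v)"
  unfolding pos_count_eq_sum
proof (rule sum.cong)
  show "smoothed_step \<rho> (v $ i) \<mu> = of_bool (v $ i > 0)" for i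
  proof (cases "v $ i > 0")
    case True
    then have "v $ i \<ge> \<alpha> * \<mu>" using assms(5)[of i] by auto
    then show ?thesis
      using True smoothed_step_eq_1[OF assms(1) _ assms(4), of \<alpha>] assms(2) by auto
  next
    case False
    then show ?thesis
      using smoothed_step_nonpos[OF _ assms(4)] assms(2) by auto
  qed
qed simp

lemma C1_map_continuous_on:
  assumes "C1_map g"
  shows "continuous_on S g"
  using assms unfolding C1_map_def
  by (metis has_derivative_continuous continuous_at_imp_continuous_on)

lemma continuous_on_sum_smoothed_step:
  fixes g :: "'a::real_normed_vector \<Rightarrow> real ^ 'k"
  assumes "density_function \<rho>" and "C1_map g"
  shows "continuous_on S (\<lambda>x. \<Sum>i\<in>UNIV. smoothed_step \<rho> (g x $ i) \<mu>)"
  by (intro continuous_on_sum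
      continuous_on_compose2[OF continuous_on_smoothed_step[OF assms(1), of UNIV]]
      continuous_on_component C1_map_continuous_on assms(2)) auto

section \<open>Minimizers of a function and of a relaxation of it\<close>

lemma global_min_imp_local_minimizer:
  assumes "x \<in> S" and "\<And>z. z \<in> S \<Longrightarrow> \<phi> x \<le> \<phi> z"
  shows "local_minimizer \<phi> S x"
  using assms unfolding local_minimizer_def by (auto intro: exI[of _ 1])

text \<open>A minimum of the relaxation \<open>\<psi>\<close> is attained on the compact set, and there \<open>\<psi>\<close> equals \<open>\<phi>\<close>.
  So the two functions have the same minimal value, and every minimizer of either one attains it
  for both.\<close>

lemma minimizer_relaxation_iff:
  fixes \<phi> \<psi> :: "'a::metric_space \<Rightarrow> real"
  assumes "compact S" and "continuous_on S \<psi>"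
    and le: "\<And>z. \<psi> z \<le> \<phi> z"
    and tight: "\<And>z. local_minimizer \<psi> S z \<Longrightarrow> \<psi> z = \<phi> z"
    and "x \<in> S"
  shows "(\<forall>z\<in>S. \<phi> x \<le> \<phi> z) \<longleftrightarrow> (\<forall>z\<in>S. \<psi> x \<le> \<psi> z)"
proof
  assume min: "\<forall>z\<in>S. \<phi> x \<le> \<phi> z"
  obtain w where w: "w \<in> S" "\<And>z. z \<in> S \<Longrightarrow> \<psi> w \<le> \<psi> z"
    using continuous_attains_inf[OF assms(1) _ assms(2)] \<open>x \<in> S\<close> by blast
  have "\<psi> x \<le> \<phi> x" by (rule le)
  also have "\<dots> \<le> \<phi> w" using min w(1) by blast
  also have "\<dots> = \<psi> w" using tight[OF global_min_imp_local_minimizer[of w S \<psi>]] w by simp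
  finally show "\<forall>z\<in>S. \<psi> x \<le> \<psi> z" using w(2) by force
next
  assume min: "\<forall>z\<in>S. \<psi> x \<le> \<psi> z"
  then have "\<psi> x = \<phi> x"
    using tight[OF global_min_imp_local_minimizer[of x S \<psi>]] \<open>x \<in> S\<close> by blast
  then show "\<forall>z\<in>S. \<phi> x \<le> \<phi> z" using min le by (metis order_trans)
qed

lemma saddle_point_iff:
  "saddle_point F X Y (x, y) \<longleftrightarrow>
     x \<in> X \<and> y \<in> Y \<and> (\<forall>z\<in>X. F x y \<le> F z y) \<and> (\<forall>z\<in>Y. - F x y \<le> - F x z)"
  unfolding saddle_point_def by auto

lemma local_saddle_point_imp_local_minimizer:
  assumes "local_saddle_point F X Y (x, y)"
  shows "local_minimizer (\<lambda>z. F z y) X x"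
proof -
  obtain \<delta> where "x \<in> X" "y \<in> Y" "\<delta> > 0"
    and "\<forall>x'\<in>X \<inter> cball x \<delta>. \<forall>y'\<in>Y \<inter> cball y \<delta>. F x y' \<le> F x y \<and> F x y \<le> F x' y"
    using assms unfolding local_saddle_point_def by auto
  moreover from this have "y \<in> Y \<inter> cball y \<delta>" by simp
  ultimately show ?thesis
    unfolding local_minimizer_def by blast
qed

lemma local_saddle_point_imp_local_maximizer:
  assumes "local_saddle_point F X Y (x, y)"
  shows "local_maximizer (F x) Y y"
proof -
  obtain \<delta> where "x \<in> X" "y \<in> Y" "\<delta> > 0"
    and "\<forall>x'\<in>X \<inter> cball x \<delta>. \<forall>y'\<in>Y \<inter> cball y \<delta>. F x y' \<le> F x y \<and> F x y \<le> F x' y"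
    using assms unfolding local_saddle_point_def by auto
  moreover from this have "x \<in> X \<inter> cball x \<delta>" by simp
  ultimately show ?thesis
    unfolding local_maximizer_def by blast
qed

section \<open>Saddle points of the original and the smoothed problem\<close>

theorem theorem4p1:
  fixes c :: "(real ^ 'n) \<times> (real ^ 'm) \<Rightarrow> real"
    and g :: "real ^ 'n \<Rightarrow> real ^ 'p"
    and h :: "real ^ 'm \<Rightarrow> real ^ 'q"
    and X :: "(real ^ 'n) set" and Y :: "(real ^ 'm) set"
    and lam1 lam2 \<alpha> \<mu> :: real
    and \<rho> :: "real \<Rightarrow> real"
    and xs :: "real ^ 'n" and ys :: "real ^ 'm"
  assumes "\<exists>L. L-lipschitz_on UNIV c"
    and "\<And>y. convex_on UNIV (\<lambda>x. c (x, y))"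
    and "\<And>x. concave_on UNIV (\<lambda>y. c (x, y))"
    and "C1_map g" and "C1_map h"
    and "convex X" and "compact X" and "convex Y" and "compact Y"
    and "lam1 > 0" and "lam2 > 0"
    and "piecewise_continuous \<rho>" and "density_function \<rho>"
    and "\<alpha> > 0" and "\<And>s. s \<notin> {0..\<alpha>} \<Longrightarrow> \<rho> s = 0"
    and "\<mu> > 0"
    and "\<And>y0 x0 i. y0 \<in> Y \<Longrightarrow>
           local_minimizer (\<lambda>x. smoothed_obj c g h lam1 lam2 \<rho> x y0 \<mu>) X x0 \<Longrightarrow>
           g x0 $ i \<notin> {0<..<\<alpha> * \<mu>}"
    and "\<And>x0 y0 j. x0 \<in> X \<Longrightarrow>
           local_maximizer (\<lambda>y. smoothed_obj c g h lam1 lam2 \<rho> x0 y \<mu>) Y y0 \<Longrightarrow>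
           h y0 $ j \<notin> {0<..<\<alpha> * \<mu>}"
  shows "(saddle_point (obj c g h lam1 lam2) X Y (xs, ys) \<longleftrightarrow>
          saddle_point (\<lambda>x y. smoothed_obj c g h lam1 lam2 \<rho> x y \<mu>) X Y (xs, ys))
       \<and> (local_saddle_point (\<lambda>x y. smoothed_obj c g h lam1 lam2 \<rho> x y \<mu>) X Y (xs, ys) \<longrightarrow>
          local_saddle_point (obj c g h lam1 lam2) X Y (xs, ys))"
proof -
  define A :: "real ^ 'n \<Rightarrow> real" where "A x = lam1 * real (pos_count (g x))" for x
  define B :: "real ^ 'm \<Rightarrow> real" where "B y = lam2 * real (pos_count (h y))" for y
  define a :: "real ^ 'n \<Rightarrow> real" where "a x = lam1 * (\<Sum>i\<in>UNIV. smoothed_step \<rho> (g x $ i) \<mu>)" for x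
  define b :: "real ^ 'm \<Rightarrow> real" where "b y = lam2 * (\<Sum>j\<in>UNIV. smoothed_step \<rho> (h y $ j) \<mu>)" for y
  let ?F = "obj c g h lam1 lam2" and ?R = "\<lambda>x y. smoothed_obj c g h lam1 lam2 \<rho> x y \<mu>"
  have F: "?F x y = c (x, y) + A x - B y" and R: "?R x y = c (x, y) + a x - b y" for x y
    by (simp_all add: obj_def smoothed_obj_def A_def B_def a_def b_def)
  note density = \<open>density_function \<rho>\<close> and supp = assms(15) and pos = \<open>\<alpha> > 0\<close> \<open>\<mu> > 0\<close>
  have aA: "a x \<le> A x" and bB: "b y \<le> B y" for x y
    using sum_smoothed_step_le_pos_count[OF density _ \<open>\<mu> > 0\<close>] supp \<open>lam1 > 0\<close> \<open>lam2 > 0\<close>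
    by (auto simp: A_def a_def B_def b_def intro!: mult_left_mono)
  have a_eq: "a x = A x" if "y \<in> Y" "local_minimizer (\<lambda>x. ?R x y) X x" for x y
    using sum_smoothed_step_eq_pos_count[OF density supp pos assms(17)[OF that]]
    by (simp add: A_def a_def)
  have b_eq: "b y = B y" if "x \<in> X" "local_maximizer (?R x) Y y" for x y
    using sum_smoothed_step_eq_pos_count[OF density supp pos assms(18)[OF that]]
    by (simp add: B_def b_def)
  obtain L where "L-lipschitz_on UNIV c" using assms(1) by blast
  then have cont_c: "continuous_on UNIV c" by (rule lipschitz_on_continuous_on)
  have cont_x: "continuous_on X (\<lambda>x. ?R x y)" for y
    unfolding R a_def
    by (intro continuous_intros continuous_on_sum_smoothed_step density \<open>C1_map g\<close>
        continuous_on_compose2[OF cont_c]) auto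
  have cont_y: "continuous_on Y (\<lambda>y. - ?R x y)" for x
    unfolding R b_def
    by (intro continuous_intros continuous_on_sum_smoothed_step density \<open>C1_map h\<close>
        continuous_on_compose2[OF cont_c]) auto

  \<comment> \<open>The penalty of the other variable has to be dropped before the two objectives are ordered:
    it is a constant here, but it enters them with the opposite sign.\<close>
  have min_iff: "(\<forall>z\<in>X. ?F x y \<le> ?F z y) \<longleftrightarrow> (\<forall>z\<in>X. ?R x y \<le> ?R z y)"
    if "x \<in> X" "y \<in> Y" for x y
  proof -
    have "(\<forall>z\<in>X. ?R x y + b y \<le> ?R z y + b y) \<longleftrightarrow> (\<forall>z\<in>X. ?F x y + B y \<le> ?F z y + B y)"
    proof (rule minimizer_relaxation_iff[symmetric])
      show "continuous_on X (\<lambda>z. ?R z y + b y)" by (intro continuous_intros cont_x)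
      show "?R z y + b y \<le> ?F z y + B y" for z using aA by (simp add: F R)
      show "?R z y + b y = ?F z y + B y" if "local_minimizer (\<lambda>z. ?R z y + b y) X z" for z
        using a_eq[OF \<open>y \<in> Y\<close>, of z] that by (simp add: local_minimizer_def F R)
    qed (use that \<open>compact X\<close> in auto)
    then show ?thesis by simp
  qed
  have max_iff: "(\<forall>z\<in>Y. - ?F x y \<le> - ?F x z) \<longleftrightarrow> (\<forall>z\<in>Y. - ?R x y \<le> - ?R x z)"
    if "x \<in> X" "y \<in> Y" for x y
  proof -
    have "(\<forall>z\<in>Y. - ?R x y + a x \<le> - ?R x z + a x) \<longleftrightarrow> (\<forall>z\<in>Y. - ?F x y + A x \<le> - ?F x z + A x)"
    proof (rule minimizer_relaxation_iff[symmetric])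
      show "continuous_on Y (\<lambda>z. - ?R x z + a x)" by (intro continuous_on_add cont_y continuous_on_const)
      show "- ?R x z + a x \<le> - ?F x z + A x" for z using bB by (simp add: F R)
      show "- ?R x z + a x = - ?F x z + A x" if "local_minimizer (\<lambda>z. - ?R x z + a x) Y z" for z
      proof -
        have "local_maximizer (?R x) Y z"
          using that by (simp add: local_minimizer_def local_maximizer_def)
        then show ?thesis using b_eq[OF \<open>x \<in> X\<close>] by (simp add: F R)
      qed
    qed (use that \<open>compact Y\<close> in auto)
    then show ?thesis by simp
  qed

  have "saddle_point ?F X Y (xs, ys) \<longleftrightarrow> saddle_point ?R X Y (xs, ys)"
    unfolding saddle_point_iff using min_iff max_iff by blast
  moreover have "local_saddle_point ?F X Y (xs, ys)" if loc: "local_saddle_point ?R X Y (xs, ys)"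
  proof -
    obtain \<delta> where mem: "xs \<in> X" "ys \<in> Y" and "\<delta> > 0"
      and saddle: "\<And>x y. x \<in> X \<inter> cball xs \<delta> \<Longrightarrow> y \<in> Y \<inter> cball ys \<delta> \<Longrightarrow>
        ?R xs y \<le> ?R xs ys \<and> ?R xs ys \<le> ?R x ys"
      using loc unfolding local_saddle_point_def by auto
    have eq: "a xs = A xs" "b ys = B ys"
      using a_eq[OF mem(2) local_saddle_point_imp_local_minimizer[OF loc]]
        b_eq[OF mem(1) local_saddle_point_imp_local_maximizer[OF loc]] by auto
    have "?F xs y \<le> ?F xs ys \<and> ?F xs ys \<le> ?F x ys"
      if "x \<in> X \<inter> cball xs \<delta>" "y \<in> Y \<inter> cball ys \<delta>" for x y
      using saddle[OF that] eq aA[of x] bB[of y] by (simp add: F R)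
    then show ?thesis
      unfolding local_saddle_point_def using mem \<open>\<delta> > 0\<close> by blast
  qed
  ultimately show ?thesis by blast
qed

end
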